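(* Let $m$ be a non-negative integer and $\alpha,\beta>0$. For $z\in\mathbb{C}$ with $|z|<1$, $$\big(P_m^{(\alpha,\beta)}(1-2z)\big)^2=\Big(\frac{(\alpha+1)_m}{m!}\Big)^2F^2(-m,m+\alpha+\beta+1;\alpha+1;z)=\Big(\frac{(\alpha+1)_m}{m!}\Big)^2\sum_{n=0}^\infty u_n z^n,$$ where $u_0=1$, $u_1=-2m(m+\alpha+\beta+1)/(\alpha+1)$ and, for all $n\ge1$, $u_{n+1}=A(n)u_n+B(n)u_{n-1}$ with $$\begin{aligned}(n+1)(\alpha+n+1)(2\alpha+n+1)A(n)={}&-2m^2(2\alpha+2n+1)-2m(\alpha+\beta+1)(2\alpha+2n+1)\\&+n\left(4\alpha(\alpha+\beta+1)+\beta+2n^2+3n(2\alpha+\beta+1)+1\right),\end{aligned}$$ $$B(n)=\frac{(2m-n+1)(\alpha+\beta+n)(2\alpha+2\beta+2m+n+1)}{(n+1)(\alpha+n+1)(2\alpha+n+1)}.$$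
   Context: $P_m^{(\alpha,\beta)}$ is the Jacobi polynomial with the standard normalization $P_m^{(\alpha,\beta)}(1)=(\alpha+1)_m/m!$. $F(a,b;c;z)=\sum_{k=0}^\infty \frac{(a)_k(b)_k}{(c)_k\,k!}z^k$, $|z|<1$, is the Gaussian hypergeometric function, with $(x)_k=x(x+1)\cdots(x+k-1)$, $(x)_0=1$; $F^2$ denotes its square. *)

theory Defs
  imports "HOL-Analysis.Analysis" "HOL-Computational_Algebra.Polynomial"
begin

(* For a, b > -1: the polynomial of degree m that is orthogonal on [-1,1], with respect to
   the weight (1-x)^a (1+x)^b, to all polynomials of smaller degree, in the standard
   normalization P(1) = (a+1)_m / m!.  These conditions determine it uniquely
   (the normalization is possible since P(1) is never 0). *)
definition jacobi_poly :: "nat \<Rightarrow> real \<Rightarrow> real \<Rightarrow> real poly" where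
  "jacobi_poly m a b = (THE p.
     degree p = m \<and>
     (\<forall>q. degree q < m \<longrightarrow>
        integral {-1..1} (\<lambda>x. (1 - x) powr a * (1 + x) powr b * poly p x * poly q x) = 0) \<and>
     poly p 1 = pochhammer (a + 1) m / fact m)"

definition Jacobi :: "nat \<Rightarrow> real \<Rightarrow> real \<Rightarrow> complex \<Rightarrow> complex" where
  "Jacobi m a b w = poly (map_poly complex_of_real (jacobi_poly m a b)) w"

(* Intended for |z| < 1 and c not in {0, -1, -2, ...}. *)
definition hypergeom_2F1 :: "complex \<Rightarrow> complex \<Rightarrow> complex \<Rightarrow> complex \<Rightarrow> complex" where
  "hypergeom_2F1 a b c z =
     (\<Sum>k. pochhammer a k * pochhammer b k / (pochhammer c k * fact k) * z ^ k)"

end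

theory Submission
  imports Defs
begin

text \<open>
  Write \<open>b = m + \<alpha> + \<beta> + 1\<close>, \<open>c = \<alpha> + 1\<close>. Since the first parameter of the hypergeometric series
  is \<open>-m\<close>, the series is a polynomial \<open>f\<close> of degree \<open>m\<close>, and both equations of the theorem are
  statements about \<open>f\<close>. Both come from the hypergeometric differential equation of \<open>f\<close>
  (\<open>hyp_poly_ode\<close>), which is the two-term recurrence of its coefficients.

  For the Jacobi polynomial, substitute \<open>(1 - x) / 2\<close> into \<open>f\<close>. The equation becomes an eigenvalue
  equation for the operator \<open>L p = (1 - x\<^sup>2) p'' + (\<beta> - \<alpha> - (\<alpha> + \<beta> + 2) x) p'\<close>. This operator is
  symmetric for the inner product with weight \<open>(1 - x)\<^sup>\<alpha> (1 + x)\<^sup>\<beta>\<close> (\<open>jacobi_op_symmetric\<close>), and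
  it maps \<open>x\<^sup>n\<close> to \<open>- n (n + \<alpha> + \<beta> + 1) x\<^sup>n\<close> plus terms of lower degree. These
  eigenvalues are distinct, so an eigenpolynomial for index \<open>m\<close> is orthogonal to everything of degree below \<open>m\<close> (\<open>jacobi_eigenpoly_orthogonal\<close>). Orthogonality and the value at
  \<open>1\<close> determine the polynomial (\<open>orthogonal_poly_unique\<close>), which identifies the Jacobi polynomial.

  For the square, eliminate \<open>f\<close> from \<open>g = f\<^sup>2\<close> and its derivatives: \<open>g\<close> satisfies a linear equation of
  third order (\<open>square_third_order_ode\<close>). In the original equation the
  coefficient \<open>x (1 - x)\<close> of \<open>f''\<close> is quadratic and vanishes at \<open>0\<close>, and that of \<open>f'\<close> is linear, so comparing coefficients of \<open>x\<^sup>n\<close> involves just three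
  consecutive coefficients of \<open>g\<close>. The resulting recurrence is the one that defines \<open>u\<close>, so \<open>u\<close> is the
  coefficient sequence of \<open>g\<close>; the power series is a finite sum.
\<close>

section \<open>Real polynomials at complex arguments\<close>

lemma sums_poly_map_of_real:
  "(\<lambda>n. of_real (coeff p n) * z ^ n) sums poly (map_poly of_real p) (z::complex)"
proof -
  have "(\<lambda>n. of_real (coeff p n) * z ^ n) sums (\<Sum>n\<le>degree p. of_real (coeff p n) * z ^ n)"
    by (rule sums_finite) (auto simp: coeff_eq_0)
  then show ?thesis
    by (simp add: poly_altdef coeff_map_poly degree_map_poly)
qed

lemma poly_map_of_real_add:
  "poly (map_poly of_real (p + q)) (z::complex) = poly (map_poly of_real p) z + poly (map_poly of_real q) z"
proof -
  have "map_poly of_real (p + q) = map_poly complex_of_real p + map_poly of_real q"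
    by (rule poly_eqI) (simp add: coeff_map_poly)
  then show ?thesis by simp
qed

lemma poly_map_of_real_mult:
  "poly (map_poly of_real (p * q)) (z::complex) = poly (map_poly of_real p) z * poly (map_poly of_real q) z"
proof -
  have "map_poly of_real (p * q) = map_poly complex_of_real p * map_poly of_real q"
    by (rule poly_eqI) (simp add: coeff_map_poly coeff_mult)
  then show ?thesis by simp
qed

lemma poly_map_of_real_pcompose:
  "poly (map_poly of_real (pcompose p q)) (z::complex)
     = poly (map_poly of_real p) (poly (map_poly of_real q) z)"
  by (induction p)
     (simp_all add: pcompose_pCons poly_map_of_real_add poly_map_of_real_mult map_poly_pCons)

section \<open>Hypergeometric polynomials\<close>

definition hyp_coeff :: "nat \<Rightarrow> real \<Rightarrow> real \<Rightarrow> nat \<Rightarrow> real" where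
  "hyp_coeff m b c k =
     pochhammer (- real m) k * pochhammer b k / (pochhammer c k * fact k)"

definition hyp_poly :: "nat \<Rightarrow> real \<Rightarrow> real \<Rightarrow> real poly" where
  "hyp_poly m b c = (\<Sum>k\<le>m. monom (hyp_coeff m b c k) k)"

lemma hyp_coeff_eq_0: "k > m \<Longrightarrow> hyp_coeff m b c k = 0"
  by (simp add: hyp_coeff_def pochhammer_of_nat_eq_0_lemma)

lemma coeff_hyp_poly [simp]: "coeff (hyp_poly m b c) k = hyp_coeff m b c k"
  by (auto simp: hyp_poly_def coeff_sum hyp_coeff_eq_0)

lemma degree_hyp_poly:
  assumes "b > 0" "c > 0"
  shows "degree (hyp_poly m b c) = m"
proof (rule antisym)
  show "degree (hyp_poly m b c) \<le> m"
    by (rule degree_le) (simp add: hyp_coeff_eq_0)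
  have "hyp_coeff m b c m \<noteq> 0"
    using pochhammer_pos[OF assms(1), of m] pochhammer_pos[OF assms(2), of m]
    by (simp add: hyp_coeff_def pochhammer_of_nat_eq_0_lemma')
  then show "m \<le> degree (hyp_poly m b c)"
    by (intro le_degree) simp
qed

lemma poly_hyp_poly_0: "poly (hyp_poly m b c) 0 = 1"
  by (simp add: poly_0_coeff_0 hyp_coeff_def)

text \<open>
  Stated without division, so that it can be read as the vanishing of a coefficient of the
  hypergeometric equation.
\<close>

lemma hyp_coeff_Suc:
  assumes "c > 0"
  shows "(real k + 1) * (real k + c) * hyp_coeff m b c (Suc k)
           = (real k - real m) * (real k + b) * hyp_coeff m b c k"
proof -
  have nz: "pochhammer c k \<noteq> 0" "real k + c \<noteq> 0" "real k + 1 \<noteq> 0"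
    using pochhammer_pos[OF assms, of k] assms by auto
  have "hyp_coeff m b c (Suc k)
      = hyp_coeff m b c k * ((real k - real m) * (real k + b)) / ((real k + 1) * (real k + c))"
    by (simp add: hyp_coeff_def pochhammer_Suc add.commute mult_ac)
  with nz show ?thesis by simp
qed

lemma hypergeom_2F1_eq_hyp_poly:
  "hypergeom_2F1 (- of_nat m) (of_real b) (of_real c) z
     = poly (map_poly complex_of_real (hyp_poly m b c)) z"
proof -
  have poch: "pochhammer (of_real x) k = (of_real (pochhammer x k) :: complex)" for x :: real and k
    by (rule pochhammer_of_real)
  have "hypergeom_2F1 (- of_nat m) (of_real b) (of_real c) z
          = (\<Sum>k. of_real (hyp_coeff m b c k) * z ^ k)"
    using poch[of "- real m"] by (simp add: hypergeom_2F1_def hyp_coeff_def poch)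
  also have "\<dots> = poly (map_poly complex_of_real (hyp_poly m b c)) z"
    using sums_poly_map_of_real[of "hyp_poly m b c" z] by (simp add: sums_iff)
  finally show ?thesis .
qed

section \<open>Second-order operators and their action on coefficients\<close>

text \<open>
  Used for the hypergeometric equation, where \<open>r0 = 0\<close> leaves two consecutive coefficients, and for
  the Jacobi operator, where it shows that coefficient \<open>i\<close> of the image depends only on coefficients
  of index at least \<open>i\<close>, so that the operator does not raise degrees.
\<close>

lemma coeff_second_order:
  fixes p :: "real poly"
  shows "coeff ([:r0, r1, r2:] * pderiv (pderiv p) + [:s0, s1:] * pderiv p) i
     = r0 * (real i + 2) * (real i + 1) * coeff p (i + 2)
       + (r1 * real i + s0) * (real i + 1) * coeff p (i + 1)
       + (r2 * (real i - 1) + s1) * real i * coeff p i"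
proof (cases i)
  case (Suc j)
  then show ?thesis
    by (cases j) (simp_all add: coeff_pderiv coeff_pCons algebra_simps)
qed (simp add: coeff_pderiv algebra_simps)

lemma hyp_poly_ode:
  fixes m :: nat and b c :: real
  assumes "c > 0"
  defines "y \<equiv> hyp_poly m b c"
  shows "[:0, 1, -1:] * pderiv (pderiv y) + [:c, real m - b - 1:] * pderiv y
           + smult (real m * b) y = 0"
proof (rule poly_eqI)
  fix i
  show "coeff ([:0, 1, -1:] * pderiv (pderiv y) + [:c, real m - b - 1:] * pderiv y
           + smult (real m * b) y) i = coeff 0 i"
    using hyp_coeff_Suc[OF assms(1), of i m b]
    unfolding coeff_add[of _ "smult _ _"] coeff_second_order
    by (simp add: y_def algebra_simps)
qed

section \<open>The square of a solution\<close>

text \<open>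
  The left-hand side for \<open>y\<^sup>2\<close> is a combination of the equation \<open>R = 0\<close> for \<open>y\<close> and its derivative
  \<open>R' = 0\<close>, with polynomial multipliers, so the identity holds in the polynomial
  ring itself. It is the symmetric square of a second-order equation, cleared of denominators.
\<close>

lemma square_third_order_ode:
  fixes P Q y :: "'a::idom poly"
  assumes ode: "P * pderiv (pderiv y) + Q * pderiv y + smult l y = 0"
  defines "g \<equiv> y^2"
  shows "P^2 * pderiv (pderiv (pderiv g)) + 3 * P * Q * pderiv (pderiv g)
          + (P * pderiv Q - pderiv P * Q + 2 * Q^2 + smult (4 * l) P) * pderiv g
          + (smult (4 * l) Q - smult (2 * l) (pderiv P)) * g = 0"
proof -
  define y1 y2 y3 where "y1 = pderiv y" and "y2 = pderiv y1" and "y3 = pderiv y2"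
  \<comment> \<open>Scalars become constant polynomials so that the ring solver can treat them uniformly.\<close>
  define k where "k = [:l:]"
  have sm: "smult l p = k * p" "smult (4 * l) p = 4 * k * p" "smult (2 * l) p = 2 * k * p" for p
    by (simp_all add: k_def numeral_poly mult.commute)
  have dk: "pderiv k = 0"
    by (simp add: k_def pderiv_pCons)
  have g1: "pderiv g = 2 * y * y1"
    by (simp add: g_def y1_def power2_eq_square pderiv_mult algebra_simps)
  have num: "pderiv (2 * p) = 2 * pderiv p" for p :: "'a poly"
    by (simp add: numeral_poly pderiv_smult)
  have g2: "pderiv (pderiv g) = 2 * (y1^2 + y * y2)"
    by (simp add: g1 num mult.assoc y1_def y2_def power2_eq_square pderiv_mult algebra_simps)
  have g3: "pderiv (pderiv (pderiv g)) = 2 * (3 * y1 * y2 + y * y3)"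
    unfolding g2 num
    by (simp add: y1_def y2_def y3_def power2_eq_square pderiv_mult pderiv_add algebra_simps)
  have R: "P * y2 + Q * y1 + k * y = 0"
    using ode by (simp add: y1_def y2_def sm)
  have "pderiv (P * pderiv (pderiv y) + Q * pderiv y + smult l y) = 0"
    by (simp add: ode)
  then have R': "P * y3 + pderiv P * y2 + Q * y2 + pderiv Q * y1 + k * y1 = 0"
    by (simp add: y1_def y2_def y3_def pderiv_add pderiv_mult sm dk algebra_simps)
  \<comment> \<open>The multiplier of \<open>R'\<close> is forced by the third derivative of \<open>y\<close>; the multiplier of \<open>R\<close> is what then remains.\<close>
  have "P^2 * (2 * (3 * y1 * y2 + y * y3)) + 3 * P * Q * (2 * (y1^2 + y * y2))
          + (P * pderiv Q - pderiv P * Q + 2 * Q^2 + 4 * k * P) * (2 * y * y1)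
          + (4 * k * Q - 2 * k * pderiv P) * y^2
        = 2 * y * P * (P * y3 + pderiv P * y2 + Q * y2 + pderiv Q * y1 + k * y1)
          + (6 * P * y1 + (4 * Q - 2 * pderiv P) * y) * (P * y2 + Q * y1 + k * y)"
    by algebra
  also have "\<dots> = 0"
    unfolding R R' by simp
  finally show ?thesis
    unfolding g3 unfolding g2 unfolding g1 sm unfolding g_def .
qed

text \<open>
  The factors of the derivatives of \<open>g\<close>, from the third down to \<open>g\<close> itself, have lowest
  terms of order at least \<open>2, 1, 0, 0\<close> and degrees at most \<open>4, 3, 2, 1\<close>, so every term shifts the
  index by \<open>1\<close>, \<open>0\<close> or \<open>-1\<close>. The first claim is the coefficient of \<open>x\<^bsup>n+1\<^esup>\<close>, the second the constant coefficient.
\<close>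

lemma third_order_coeff_recurrence:
  fixes g :: "real poly" and c e l :: real
  assumes ode: "[:0, 1, -1:]^2 * pderiv (pderiv (pderiv g))
          + 3 * [:0, 1, -1:] * [:c, -e:] * pderiv (pderiv g)
          + ([:0, 1, -1:] * pderiv [:c, -e:] - pderiv [:0, 1, -1:] * [:c, -e:]
              + 2 * [:c, -e:]^2 + smult (4 * l) [:0, 1, -1:]) * pderiv g
          + (smult (4 * l) [:c, -e:] - smult (2 * l) (pderiv [:0, 1, -1:])) * g = 0"
  shows "(real n + 2) * (real n + 1 + c) * (real n + 2 * c) * coeff g (n + 2)
     = ((real n + 1) * (2 * real n * (real n - 1) + 3 * (c + e) * real n + 4 * c * e - 2 * c - 4 * l)
           - l * (4 * c - 2)) * coeff g (n + 1)
       - (real n * (real n - 1) * (real n - 2) + 3 * e * real n * (real n - 1)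
           + (2 * e^2 - e - 4 * l) * real n + l * (4 - 4 * e)) * coeff g n"
    and "c * (2 * c - 1) * coeff g 1 = - l * (4 * c - 2) * coeff g 0"
proof -
  have three: "(3::real poly) = [:3:]" and two: "(2::real poly) = [:2:]"
    by (simp_all add: numeral_poly)
  have eq: "[:0, 0, 1, -2, 1:] * pderiv (pderiv (pderiv g))
          + [:0, 3 * c, - 3 * (c + e), 3 * e:] * pderiv (pderiv g)
          + [:2 * c^2 - c, 2 * c - 4 * c * e + 4 * l, 2 * e^2 - e - 4 * l:] * pderiv g
          + [:l * (4 * c - 2), l * (4 - 4 * e):] * g = 0"
  proof -
    have "[:0, 0, 1, -2, 1:] = [:0, 1, -1::real:]^2"
      by (simp add: power2_eq_square)
    moreover have "[:0, 3 * c, - 3 * (c + e), 3 * e:] = 3 * [:0, 1, -1:] * [:c, -e:]"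
      by (simp add: three algebra_simps)
    moreover have "[:2 * c^2 - c, 2 * c - 4 * c * e + 4 * l, 2 * e^2 - e - 4 * l:]
        = [:0, 1, -1:] * pderiv [:c, -e:] - pderiv [:0, 1, -1:] * [:c, -e:]
              + 2 * [:c, -e:]^2 + smult (4 * l) [:0, 1, -1:]"
      by (simp add: two power2_eq_square pderiv_pCons algebra_simps)
    moreover have "[:l * (4 * c - 2), l * (4 - 4 * e):]
        = smult (4 * l) [:c, -e:] - smult (2 * l) (pderiv [:0, 1, -1:])"
      by (simp add: pderiv_pCons algebra_simps)
    ultimately show ?thesis
      using ode by metis
  qed
  have zero: "coeff ([:0, 0, 1, -2, 1:] * pderiv (pderiv (pderiv g))
          + [:0, 3 * c, - 3 * (c + e), 3 * e:] * pderiv (pderiv g)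
          + [:2 * c^2 - c, 2 * c - 4 * c * e + 4 * l, 2 * e^2 - e - 4 * l:] * pderiv g
          + [:l * (4 * c - 2), l * (4 - 4 * e):] * g) i = 0" for i
    by (simp only: eq coeff_0)
  show "c * (2 * c - 1) * coeff g 1 = - l * (4 * c - 2) * coeff g 0"
    using zero[of 0] by (simp add: coeff_pderiv power2_eq_square algebra_simps)
  \<comment> \<open>For small \<open>n\<close> some of the shifted indices would be negative; the coefficients concerned are zero.\<close>
  consider "n = 0" | "n = 1" | "n = 2" | j where "n = Suc (Suc (Suc j))"
    by (metis One_nat_def numeral_2_eq_2 not0_implies_Suc)
  then show "(real n + 2) * (real n + 1 + c) * (real n + 2 * c) * coeff g (n + 2)
     = ((real n + 1) * (2 * real n * (real n - 1) + 3 * (c + e) * real n + 4 * c * e - 2 * c - 4 * l)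
           - l * (4 * c - 2)) * coeff g (n + 1)
       - (real n * (real n - 1) * (real n - 2) + 3 * e * real n * (real n - 1)
           + (2 * e^2 - e - 4 * l) * real n + l * (4 - 4 * e)) * coeff g n"
    using zero[of "Suc n"]
    by cases (simp_all add: coeff_pderiv coeff_pCons power2_eq_square algebra_simps
        numeral_2_eq_2 numeral_3_eq_3)
qed

section \<open>Jacobi polynomials\<close>

definition jacobi_op :: "real \<Rightarrow> real \<Rightarrow> real poly \<Rightarrow> real poly" where
  "jacobi_op a b p = [:1, 0, -1:] * pderiv (pderiv p) + [:b - a, - (a + b + 2):] * pderiv p"

definition jacobi_inner :: "real \<Rightarrow> real \<Rightarrow> real poly \<Rightarrow> real poly \<Rightarrow> real" where
  "jacobi_inner a b p q =
     integral {-1..1} (\<lambda>x. (1 - x) powr a * (1 + x) powr b * poly p x * poly q x)"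

text \<open>
  For positive exponents the weight extends continuously by \<open>0\<close> to the endpoints, and this agrees
  with the convention for \<open>0 powr a\<close>. All integrability questions are settled by this.
\<close>

lemma continuous_jacobi_integrand:
  assumes "a > 0" "b > 0"
  shows "continuous_on {-1..1} (\<lambda>x::real. (1 - x) powr a * (1 + x) powr b * poly p x * poly q x)"
  using assms by (intro continuous_intros continuous_on_powr') auto

lemma jacobi_integrable:
  assumes "a > 0" "b > 0"
  shows "(\<lambda>x::real. (1 - x) powr a * (1 + x) powr b * poly p x * poly q x) integrable_on {-1..1}"
  using continuous_jacobi_integrand[OF assms] by (rule integrable_continuous_real)

lemma jacobi_inner_add_right:
  assumes "a > 0" "b > 0"
  shows "jacobi_inner a b p (q + r) = jacobi_inner a b p q + jacobi_inner a b p r"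
  unfolding jacobi_inner_def poly_add distrib_left
  by (intro integral_add jacobi_integrable assms)

lemma jacobi_inner_smult_right:
  "jacobi_inner a b p (smult k q) = k * jacobi_inner a b p q"
  unfolding jacobi_inner_def
  by (subst integral_mult_right[symmetric]) (simp add: algebra_simps)

lemma jacobi_inner_commute: "jacobi_inner a b p q = jacobi_inner a b q p"
  by (simp add: jacobi_inner_def mult.commute mult.left_commute)

text \<open>
  Lagrange's identity: with \<open>w\<close> the weight, \<open>w (L p \<cdot> q - p \<cdot> L q)\<close> is the derivative of
  \<open>(1 - x\<^sup>2) w (p' q - p q')\<close>, which vanishes at both endpoints.
\<close>

lemma jacobi_op_symmetric:
  assumes "a > 0" "b > 0"
  shows "jacobi_inner a b (jacobi_op a b p) q = jacobi_inner a b p (jacobi_op a b q)"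
proof -
  define w where "w x = (1 - x) powr a * (1 + x) powr b" for x :: real
  define V where "V = pderiv p * q - p * pderiv q"
  define W where "W x = (1 - x) powr (a + 1) * (1 + x) powr (b + 1) * poly V x" for x :: real
  have "((\<lambda>x. w x * poly (jacobi_op a b p) x * poly q x
              - w x * poly p x * poly (jacobi_op a b q) x) has_integral (W 1 - W (-1))) {-1..1}"
  proof (rule fundamental_theorem_of_calculus_interior)
    show "continuous_on {-1..1} W"
      unfolding W_def using assms by (intro continuous_intros continuous_on_powr') auto
    fix x :: real assume x: "x \<in> {-1<..<1}"
    have "((\<lambda>x. (1 - x) powr (a + 1)) has_real_derivative - ((a + 1) * (1 - x) powr a)) (at x)"
      using x by (auto intro!: derivative_eq_intros)
    moreover have "((\<lambda>x. (1 + x) powr (b + 1)) has_real_derivative (b + 1) * (1 + x) powr b) (at x)"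
      using x by (auto intro!: derivative_eq_intros)
    ultimately have "(W has_real_derivative
         (- ((a + 1) * (1 - x) powr a) * (1 + x) powr (b + 1)
          + (b + 1) * (1 + x) powr b * (1 - x) powr (a + 1)) * poly V x
         + poly (pderiv V) x * ((1 - x) powr (a + 1) * (1 + x) powr (b + 1))) (at x)"
      unfolding W_def by (intro DERIV_mult poly_DERIV)
    also have "(1 - x) powr (a + 1) = (1 - x) powr a * (1 - x)"
      using x by (simp add: powr_add)
    also have "(1 + x) powr (b + 1) = (1 + x) powr b * (1 + x)"
      using x by (simp add: powr_add)
    also have "(- ((a + 1) * (1 - x) powr a) * ((1 + x) powr b * (1 + x))
          + (b + 1) * (1 + x) powr b * ((1 - x) powr a * (1 - x))) * poly V x
         + poly (pderiv V) x * ((1 - x) powr a * (1 - x) * ((1 + x) powr b * (1 + x)))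
       = w x * poly (jacobi_op a b p) x * poly q x - w x * poly p x * poly (jacobi_op a b q) x"
      unfolding w_def V_def jacobi_op_def
      by (simp add: pderiv_diff pderiv_mult algebra_simps)
    finally show "(W has_vector_derivative
        w x * poly (jacobi_op a b p) x * poly q x - w x * poly p x * poly (jacobi_op a b q) x) (at x)"
      by (simp add: has_real_derivative_iff_has_vector_derivative)
  qed simp
  moreover have "W 1 = 0" "W (-1) = 0"
    by (simp_all add: W_def)
  ultimately have "integral {-1..1} (\<lambda>x. w x * poly (jacobi_op a b p) x * poly q x
              - w x * poly p x * poly (jacobi_op a b q) x) = 0"
    by (simp add: integral_unique)
  then show ?thesis
    unfolding jacobi_inner_def w_def
    by (subst (asm) integral_diff) (auto intro!: jacobi_integrable assms)
qed

text \<open>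
  Induction on the degree of \<open>q\<close>. With \<open>l k = k (k + a + b + 1)\<close> and \<open>q\<close> of degree at most \<open>n < m\<close>,
  the term of degree \<open>n\<close> cancels in \<open>L q + l n q\<close>, which is therefore orthogonal to \<open>p\<close> by
  induction. Since \<open>L p = - l m p\<close>, symmetry of \<open>L\<close> turns this into
  \<open>(l n - l m) \<langle>p, q\<rangle> = 0\<close>, and \<open>l\<close> is strictly increasing. The degree bound is phrased by
  vanishing coefficients because the zero polynomial then needs no separate treatment.
\<close>

lemma jacobi_eigenpoly_orthogonal:
  assumes ab: "a > 0" "b > 0"
    and eigen: "jacobi_op a b p = smult (- (real m * (real m + a + b + 1))) p"
    and "n \<le> m" and "\<And>i. i \<ge> n \<Longrightarrow> coeff q i = 0"
  shows "jacobi_inner a b p q = 0"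
  using assms(4,5)
proof (induction n arbitrary: q)
  case 0
  then have "q = 0" by (intro poly_eqI) simp
  then show ?case by (simp add: jacobi_inner_def)
next
  case (Suc n)
  define l where "l k = real k * (real k + a + b + 1)" for k :: nat
  have "coeff (jacobi_op a b q + smult (l n) q) i = 0" if "i \<ge> n" for i
  proof (cases "i = n")
    case True
    then show ?thesis
      unfolding jacobi_op_def coeff_add[of _ "smult _ _"] coeff_second_order
      using Suc.prems(2)[of "n + 1"] Suc.prems(2)[of "n + 2"]
      by (simp add: l_def algebra_simps)
  next
    case False
    with that show ?thesis
      unfolding jacobi_op_def coeff_add[of _ "smult _ _"] coeff_second_order
      using Suc.prems(2)[of i] Suc.prems(2)[of "i + 1"] Suc.prems(2)[of "i + 2"]
      by simp
  qed
  then have "jacobi_inner a b p (jacobi_op a b q + smult (l n) q) = 0"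
    using Suc by simp
  then have "jacobi_inner a b p (jacobi_op a b q) + l n * jacobi_inner a b p q = 0"
    by (simp add: jacobi_inner_add_right[OF ab] jacobi_inner_smult_right)
  moreover have "jacobi_inner a b p (jacobi_op a b q) = - l m * jacobi_inner a b p q"
    unfolding jacobi_op_symmetric[OF ab, symmetric] eigen
    by (subst (1 2) jacobi_inner_commute) (simp only: jacobi_inner_smult_right l_def)
  ultimately have "(l n - l m) * jacobi_inner a b p q = 0"
    by (simp add: algebra_simps)
  moreover have "l n < l m"
    unfolding l_def using Suc.prems(1) ab by (intro mult_strict_mono) auto
  ultimately show ?case by simp
qed

lemma jacobi_inner_self_eq_0:
  assumes ab: "a > 0" "b > 0" and "jacobi_inner a b d d = 0"
  shows "d = 0"
proof (rule ccontr)
  assume "d \<noteq> 0"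
  have "\<forall>x\<in>{-1..1}. (1 - x) powr a * (1 + x) powr b * poly d x * poly d x = 0"
    using assms(3) unfolding jacobi_inner_def
    by (subst (asm) integral_eq_0_iff[OF continuous_jacobi_integrand[OF ab]])
       (auto simp: mult.assoc)
  then have "poly d x = 0" if "x \<in> {-1<..<1}" for x
    using that by (auto dest!: bspec[of _ _ x])
  then have "{-1<..<1} \<subseteq> {x. poly d x = 0}"
    by blast
  then have "finite {-1<..<1::real}"
    using poly_roots_finite[OF \<open>d \<noteq> 0\<close>] by (rule finite_subset)
  then show False
    using infinite_Ioo[of "-1::real" 1] by simp
qed

text \<open>
  Subtracting a multiple of \<open>q\<close> that cancels the leading term of \<open>p\<close> leaves a polynomial of degree
  less than \<open>m\<close> that is orthogonal to itself, hence zero. The values at \<open>1\<close> fix the multiple.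
\<close>

lemma orthogonal_poly_unique:
  assumes ab: "a > 0" "b > 0"
    and deg: "degree p = m" "degree q = m"
    and orth: "\<And>r. degree r < m \<Longrightarrow> jacobi_inner a b p r = 0"
              "\<And>r. degree r < m \<Longrightarrow> jacobi_inner a b q r = 0"
    and norm: "poly p 1 = poly q 1" "poly q 1 \<noteq> 0"
  shows "p = q"
proof -
  have "q \<noteq> 0" using norm(2) by auto
  then have lc: "coeff q m \<noteq> 0" using deg(2) by auto
  define k where "k = coeff p m / coeff q m"
  define d where "d = p + smult (- k) q"
  have dm: "coeff d m = 0" using lc by (simp add: d_def k_def)
  have "degree d \<le> m"
    unfolding d_def using deg by (intro degree_add_le) (auto intro: order.trans[OF degree_smult_le])
  have "d = 0"
  proof (cases "degree d < m")
    case True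
    have "jacobi_inner a b d d = jacobi_inner a b d p + (- k) * jacobi_inner a b d q"
      unfolding d_def by (simp only: jacobi_inner_add_right[OF ab] jacobi_inner_smult_right)
    also have "\<dots> = 0"
      using orth[OF True] by (simp add: jacobi_inner_commute[of a b d])
    finally show ?thesis by (rule jacobi_inner_self_eq_0[OF ab])
  next
    case False
    with \<open>degree d \<le> m\<close> dm show ?thesis by (metis antisym_conv2 leading_coeff_0_iff)
  qed
  then have eq: "p = smult k q" by (simp add: d_def)
  with norm have "k = 1" by simp
  with eq show ?thesis by simp
qed

lemma jacobi_poly_eq_hyp_poly:
  assumes ab: "a > 0" "b > 0"
  shows "jacobi_poly m a b = smult (pochhammer (a + 1) m / fact m)
           (pcompose (hyp_poly m (real m + a + b + 1) (a + 1)) [:1/2, -1/2:])"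
    (is "_ = ?J")
proof -
  define K where "K = pochhammer (a + 1) m / fact m"
  define f where "f = hyp_poly m (real m + a + b + 1) (a + 1)"
  define s where "s = [:1/2, -1/2::real:]"
  have K: "K > 0"
    unfolding K_def using ab by (intro divide_pos_pos pochhammer_pos) auto
  have J: "?J = smult K (pcompose f s)"
    by (simp add: K_def f_def s_def)
  have deg: "degree ?J = m"
    unfolding J using K ab by (simp add: degree_pcompose f_def degree_hyp_poly s_def)
  have val: "poly ?J 1 = K"
    unfolding J by (simp add: poly_pcompose s_def f_def poly_hyp_poly_0)
  have "[:0, 1, -1:] * pderiv (pderiv f) + [:a + 1, - (a + b + 2):] * pderiv f
           + smult (real m * (real m + a + b + 1)) f = 0"
    using hyp_poly_ode[of "a + 1" m "real m + a + b + 1"] ab by (simp add: f_def algebra_simps)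
  then have "pcompose ([:0, 1, -1:] * pderiv (pderiv f) + [:a + 1, - (a + b + 2):] * pderiv f
           + smult (real m * (real m + a + b + 1)) f) s = 0"
    by simp
  then have ode: "pcompose [:0, 1, -1:] s * pcompose (pderiv (pderiv f)) s
        + pcompose [:a + 1, - (a + b + 2):] s * pcompose (pderiv f) s
        + smult (real m * (real m + a + b + 1)) (pcompose f s) = 0"
    by (simp only: pcompose_add pcompose_mult pcompose_smult)
  have ds: "pderiv s = [:-1/2:]"
    by (simp add: s_def pderiv_pCons)
  have d1: "pderiv (pcompose f s) = smult (-1/2) (pcompose (pderiv f) s)"
    by (simp add: pderiv_pcompose ds)
  have d2: "pderiv (pderiv (pcompose f s)) = smult (1/4) (pcompose (pderiv (pderiv f)) s)"
    unfolding d1 pderiv_smult by (simp add: pderiv_pcompose ds)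
  have "pcompose [:0, 1, -1:] s = smult (1/4) [:1, 0, -1:]"
    by (simp add: s_def pcompose_pCons)
  moreover have "pcompose [:a + 1, - (a + b + 2):] s = smult (-1/2) [:b - a, - (a + b + 2):]"
    by (simp add: s_def pcompose_pCons field_simps)
  ultimately have "jacobi_op a b (pcompose f s)
        + smult (real m * (real m + a + b + 1)) (pcompose f s) = 0"
    using ode unfolding jacobi_op_def d2 unfolding d1 by (simp only: mult_smult_left mult_smult_right)
  then have "jacobi_op a b (pcompose f s)
        = smult (- (real m * (real m + a + b + 1))) (pcompose f s)"
    by (simp only: smult_minus_left eq_neg_iff_add_eq_0)
  then have eigen: "jacobi_op a b ?J = smult (- (real m * (real m + a + b + 1))) ?J"
    unfolding J jacobi_op_def pderiv_smult mult_smult_right smult_add_right[symmetric]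
    by (simp add: mult.commute)
  have orth: "jacobi_inner a b ?J q = 0" if "degree q < m" for q
    using that by (intro jacobi_eigenpoly_orthogonal[OF ab eigen order.refl] coeff_eq_0) simp
  show ?thesis
    unfolding jacobi_poly_def
  proof (rule the_equality)
    show "degree ?J = m \<and>
     (\<forall>q. degree q < m \<longrightarrow>
        integral {-1..1} (\<lambda>x. (1 - x) powr a * (1 + x) powr b * poly ?J x * poly q x) = 0) \<and>
     poly ?J 1 = pochhammer (a + 1) m / fact m"
      using deg val orth unfolding jacobi_inner_def K_def by blast
    fix p
    assume "degree p = m \<and>
     (\<forall>q. degree q < m \<longrightarrow>
        integral {-1..1} (\<lambda>x. (1 - x) powr a * (1 + x) powr b * poly p x * poly q x) = 0) \<and>
     poly p 1 = pochhammer (a + 1) m / fact m"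
    then show "p = ?J"
      using deg val orth K unfolding jacobi_inner_def[symmetric] K_def[symmetric]
      by (intro orthogonal_poly_unique[OF ab]) auto
  qed
qed

lemma Jacobi_eq_hypergeom:
  assumes "a > 0" "b > 0"
  shows "Jacobi m a b (1 - 2 * z) = of_real (pochhammer (a + 1) m / fact m)
     * hypergeom_2F1 (- of_nat m) (of_real (real m + a + b + 1)) (of_real (a + 1)) z"
proof -
  have "poly (map_poly of_real [:1/2, -1/2:]) (1 - 2 * z) = z"
    by (simp add: map_poly_pCons algebra_simps)
  then show ?thesis
    unfolding Jacobi_def jacobi_poly_eq_hyp_poly[OF assms] hypergeom_2F1_eq_hyp_poly
    by (simp add: map_poly_smult poly_map_of_real_pcompose)
qed

section \<open>The power series of the squared polynomial\<close>

text \<open>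
  The general recurrence for \<open>c = \<alpha> + 1\<close>, \<open>e = \<alpha> + \<beta> + 2\<close> and \<open>l = m (m + \<alpha> + \<beta> + 1)\<close>. The
  step from index \<open>0\<close> to \<open>1\<close> carries a factor \<open>2 c - 1 = 2 \<alpha> + 1\<close>, which is nonzero and cancels.
\<close>

lemma hyp_poly_square_coeff_recurrence:
  fixes m :: nat and \<alpha> \<beta> :: real
  assumes "\<alpha> > 0"
  defines "g \<equiv> (hyp_poly m (real m + \<alpha> + \<beta> + 1) (\<alpha> + 1))^2"
  shows "n \<ge> 1 \<Longrightarrow> (real n + 1) * (\<alpha> + real n + 1) * (2 * \<alpha> + real n + 1) * coeff g (n + 1) =
        (- 2 * (real m)^2 * (2 * \<alpha> + 2 * real n + 1)
         - 2 * real m * (\<alpha> + \<beta> + 1) * (2 * \<alpha> + 2 * real n + 1)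
         + real n * (4 * \<alpha> * (\<alpha> + \<beta> + 1) + \<beta> + 2 * (real n)^2
                     + 3 * real n * (2 * \<alpha> + \<beta> + 1) + 1)) * coeff g n
        + (2 * real m - real n + 1) * (\<alpha> + \<beta> + real n)
            * (2 * \<alpha> + 2 * \<beta> + 2 * real m + real n + 1) * coeff g (n - 1)"
    and "coeff g 0 = 1"
    and "coeff g 1 = - 2 * real m * (real m + \<alpha> + \<beta> + 1) / (\<alpha> + 1)"
proof -
  define l where "l = real m * (real m + \<alpha> + \<beta> + 1)"
  have "[:0, 1, -1:] * pderiv (pderiv (hyp_poly m (real m + \<alpha> + \<beta> + 1) (\<alpha> + 1)))
        + [:\<alpha> + 1, - (\<alpha> + \<beta> + 2):] * pderiv (hyp_poly m (real m + \<alpha> + \<beta> + 1) (\<alpha> + 1))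
        + smult l (hyp_poly m (real m + \<alpha> + \<beta> + 1) (\<alpha> + 1)) = 0"
    using hyp_poly_ode[of "\<alpha> + 1" m "real m + \<alpha> + \<beta> + 1"] assms(1) by (simp add: l_def algebra_simps)
  note rec = third_order_coeff_recurrence[OF square_third_order_ode[OF this], folded g_def]
  show g0: "coeff g 0 = 1"
    by (simp add: g_def coeff_0_power hyp_coeff_def)
  have "(2 * \<alpha> + 1) * ((\<alpha> + 1) * coeff g 1) = (2 * \<alpha> + 1) * (- 2 * l)"
    using rec(2) by (simp add: g0 algebra_simps)
  then have "(\<alpha> + 1) * coeff g 1 = - 2 * l"
    using assms(1) by (subst (asm) mult_cancel_left) auto
  then show "coeff g 1 = - 2 * real m * (real m + \<alpha> + \<beta> + 1) / (\<alpha> + 1)"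
    using assms(1) by (simp add: field_simps l_def)
  assume "n \<ge> 1"
  then have x: "real (n - 1) = real n - 1" by auto
  have idx: "(n - 1) + 2 = n + 1" "(n - 1) + 1 = n"
    using \<open>n \<ge> 1\<close> by auto
  show "(real n + 1) * (\<alpha> + real n + 1) * (2 * \<alpha> + real n + 1) * coeff g (n + 1) =
        (- 2 * (real m)^2 * (2 * \<alpha> + 2 * real n + 1)
         - 2 * real m * (\<alpha> + \<beta> + 1) * (2 * \<alpha> + 2 * real n + 1)
         + real n * (4 * \<alpha> * (\<alpha> + \<beta> + 1) + \<beta> + 2 * (real n)^2
                     + 3 * real n * (2 * \<alpha> + \<beta> + 1) + 1)) * coeff g n
        + (2 * real m - real n + 1) * (\<alpha> + \<beta> + real n)
            * (2 * \<alpha> + 2 * \<beta> + 2 * real m + real n + 1) * coeff g (n - 1)"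
    using rec(1)[of "n - 1"] unfolding x idx l_def by algebra
qed

theorem corollary2p7:
  fixes m :: nat and \<alpha> \<beta> :: real and A B u :: "nat \<Rightarrow> real" and z :: complex
  assumes "\<alpha> > 0" and "\<beta> > 0" and "norm z < 1"
    and A: "\<And>n. n \<ge> 1 \<Longrightarrow>
      (real n + 1) * (\<alpha> + real n + 1) * (2 * \<alpha> + real n + 1) * A n =
        - 2 * (real m)^2 * (2 * \<alpha> + 2 * real n + 1)
        - 2 * real m * (\<alpha> + \<beta> + 1) * (2 * \<alpha> + 2 * real n + 1)
        + real n * (4 * \<alpha> * (\<alpha> + \<beta> + 1) + \<beta> + 2 * (real n)^2
                    + 3 * real n * (2 * \<alpha> + \<beta> + 1) + 1)"
    and B: "\<And>n. n \<ge> 1 \<Longrightarrow>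
      B n = (2 * real m - real n + 1) * (\<alpha> + \<beta> + real n)
              * (2 * \<alpha> + 2 * \<beta> + 2 * real m + real n + 1)
            / ((real n + 1) * (\<alpha> + real n + 1) * (2 * \<alpha> + real n + 1))"
    and "u 0 = 1"
    and "u 1 = - 2 * real m * (real m + \<alpha> + \<beta> + 1) / (\<alpha> + 1)"
    and "\<And>n. n \<ge> 1 \<Longrightarrow> u (n + 1) = A n * u n + B n * u (n - 1)"
  shows "(Jacobi m \<alpha> \<beta> (1 - 2 * z))^2
           = (of_real (pochhammer (\<alpha> + 1) m / fact m))^2
             * (hypergeom_2F1 (- of_nat m) (of_real (real m + \<alpha> + \<beta> + 1)) (of_real (\<alpha> + 1)) z)^2
       \<and> summable (\<lambda>n. of_real (u n) * z ^ n)
       \<and> (of_real (pochhammer (\<alpha> + 1) m / fact m))^2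
             * (hypergeom_2F1 (- of_nat m) (of_real (real m + \<alpha> + \<beta> + 1)) (of_real (\<alpha> + 1)) z)^2
           = (of_real (pochhammer (\<alpha> + 1) m / fact m))^2 * (\<Sum>n. of_real (u n) * z ^ n)"
proof -
  define f where "f = hyp_poly m (real m + \<alpha> + \<beta> + 1) (\<alpha> + 1)"
  \<comment> \<open>\<open>A\<close> and \<open>B\<close> enter the recurrence of the coefficients after multiplying by the common denominator.\<close>
  have rec: "(real n + 1) * (\<alpha> + real n + 1) * (2 * \<alpha> + real n + 1) * coeff (f^2) (n + 1)
      = (real n + 1) * (\<alpha> + real n + 1) * (2 * \<alpha> + real n + 1)
          * (A n * coeff (f^2) n + B n * coeff (f^2) (n - 1))" if "n \<ge> 1" for n
  proof -
    define D where "D = (real n + 1) * (\<alpha> + real n + 1) * (2 * \<alpha> + real n + 1)"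
    have "D \<noteq> 0"
      using assms(1) by (simp add: D_def add_pos_nonneg)
    then have DB: "D * B n = (2 * real m - real n + 1) * (\<alpha> + \<beta> + real n)
              * (2 * \<alpha> + 2 * \<beta> + 2 * real m + real n + 1)"
      using B[OF that, folded D_def] by simp
    have "D * coeff (f^2) (n + 1) = D * A n * coeff (f^2) n + D * B n * coeff (f^2) (n - 1)"
      unfolding DB unfolding D_def A[OF that] f_def
      by (rule hyp_poly_square_coeff_recurrence(1)[OF assms(1) that])
    then show ?thesis unfolding D_def[symmetric] by (simp add: distrib_left)
  qed
  have u: "u n = coeff (f^2) n" for n
  proof (induction n rule: less_induct)
    case (less n)
    consider "n = 0" | "n = 1" | k where "n = k + 1" "k \<ge> 1"
      by (metis One_nat_def Suc_eq_plus1 Suc_leI not_gr_zero old.nat.exhaust)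
    then show ?case
    proof cases
      case 3
      have "(real k + 1) * (\<alpha> + real k + 1) * (2 * \<alpha> + real k + 1) \<noteq> 0"
        using assms(1) by (simp add: add_pos_nonneg)
      then have "coeff (f^2) (k + 1) = A k * coeff (f^2) k + B k * coeff (f^2) (k - 1)"
        using rec[OF 3(2)] by (metis mult_cancel_left)
      with 3 less show ?thesis using assms(8)[of k] by simp
    qed (use hyp_poly_square_coeff_recurrence(2,3)[OF assms(1), of m \<beta>] assms(6,7)
          in \<open>simp_all add: f_def\<close>)
  qed
  have "(\<lambda>n. of_real (u n) * z ^ n) sums poly (map_poly of_real (f^2)) z"
    unfolding u by (rule sums_poly_map_of_real)
  also have "poly (map_poly of_real (f^2)) z = (poly (map_poly of_real f) z)^2"
    by (simp add: power2_eq_square poly_map_of_real_mult)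
  finally have sums: "(\<lambda>n. of_real (u n) * z ^ n) sums
      (hypergeom_2F1 (- of_nat m) (of_real (real m + \<alpha> + \<beta> + 1)) (of_real (\<alpha> + 1)) z)^2"
    by (simp only: f_def hypergeom_2F1_eq_hyp_poly)
  show ?thesis
    using sums_summable[OF sums] sums_unique[OF sums]
    by (simp only: Jacobi_eq_hypergeom[OF assms(1,2)] power_mult_distrib simp_thms)
qed

end
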